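(* Let $\mathsf{Q}=(\mathsf{Q},\&)$ be an integral and commutative quantale, and let $X$ be an $\mathcal{F}$-domain (a $\mathsf{Q}$-ordered set). Then the Scott $\mathsf{Q}$-topological space $\Sigma X=(X,\sigma(X))$ of $X$ is sober.
   Context: **Quantale.** A commutative unital quantale $(\mathsf{Q},\&)$ is a complete lattice $\mathsf{Q}$ (bottom $0$, top $1$) with a commutative associative operation $\&$ that distributes over arbitrary joins and has a unit $k$; it is integral if $k=1$. The implication is given by $p\&q\le r\iff q\le p\to r$. **$\mathsf{Q}$-orders.** A $\mathsf{Q}$-ordered set is a set $X$ with a map $X(-,-)\colon X\times X\to\mathsf{Q}$ with $X(x,x)\ge k$ and $X(y,z)\&X(x,y)\le X(x,z)$. It is separated if $k\le X(x,y)\wedge X(y,x)$ implies $x=y$. A weight of $X$ is a map $\phi\colon X\to\mathsf{Q}$ with $\phi(y)\&X(x,y)\le\phi(x)$ for all $x,y$; a coweight is a map $\psi\colon X\to\mathsf{Q}$ with $X(x,y)\&\psi(x)\le\psi(y)$ for all $x,y$. For maps $\phi_1,\phi_2\colon X\to\mathsf{Q}$ put $\mathrm{sub}_X(\phi_1,\phi_2)=\bigwedge_{x}(\phi_1(x)\to\phi_2(x))$. An element $a\in X$ is a supremum of a weight $\phi$, written $a=\sup\phi$, if $X(a,y)=\mathrm{sub}_X(\phi,X(-,y))$ for all $y\in X$. **Flat ideals.** For a weight $\phi$ and a coweight $\psi$ let $\phi\pitchfork\psi=\bigvee_{x\in X}\phi(x)\&\psi(x)$. A flat ideal of $X$ is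 a weight $\phi$ such that $\bigvee_x\phi(x)\ge k$ and $\phi\pitchfork(\psi_1\wedge\psi_2)=(\phi\pitchfork\psi_1)\wedge(\phi\pitchfork\psi_2)$ for all coweights $\psi_1,\psi_2$ ($\wedge$ pointwise). Let $\mathcal{F}X$ be the set of flat ideals of $X$ with $\mathsf{Q}$-order $\mathrm{sub}_X$. **$\mathcal{F}$-domains.** $X$ is an $\mathcal{F}$-domain if $X$ is separated, every flat ideal of $X$ has a supremum, and for each $x\in X$ there is a flat ideal $d(x)$ of $X$ such that $\mathrm{sub}_X(d(x),\phi)=X(x,\sup\phi)$ for all $\phi\in\mathcal{F}X$. (Equivalently, $X$ is separated, $\mathsf{y}_X\colon X\to\mathcal{F}X$, $x\mapsto X(-,x)$, has a left adjoint $\sup$, and $\sup$ has a left adjoint.) **Scott $\mathsf{Q}$-topology.** A map $\psi\colon X\to\mathsf{Q}$ is Scott open if it is a coweight and $\psi(\sup\phi)\le\phi\pitchfork\psi$ for each flat ideal $\phi$ of $X$ whose supremum exists. The set $\sigma(X)$ of Scott open maps is a $\mathsf{Q}$-topology on $X$, where a $\mathsf{Q}$-topology on a set $X$ is a subset of $\mathsf{Q}^X$ containing the constant map $1_X$ with value $1$ and closed under binary meets, arbitrary joins and $\lambda\mapsto\lambda\& r$ for each $r\in\mathsf{Q}$ (all pointwise); its elements are called open sets. **Sobriety.** For a $\mathsf{Q}$-topological space $X$ with set of open sets $\mathcal{O}(X)$, a point of $\mathcal{O}(X)$ is a map $p\colon\mathcal{O}(X)\to\mathsf{Q}$ with $p(1_X)=1$,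 $p(\lambda\wedge\mu)=p(\lambda)\wedge p(\mu)$, $p(\bigvee_i\lambda_i)=\bigvee_i p(\lambda_i)$ and $p(\lambda\& r)=r\& p(\lambda)$. $X$ is sober if for each point $p$ of $\mathcal{O}(X)$ there is a unique $x\in X$ with $p(\lambda)=\lambda(x)$ for all $\lambda\in\mathcal{O}(X)$. *)

theory Defs
  imports "HOL-Library.FuncSet"
begin

text \<open>
  A quantale is a type of the class below: its multiplication \<open>*\<close> is the operation \<open>&\<close>, and
  \<open>1\<close> is the unit \<open>k\<close>.  The bottom and top elements, written 0 and 1 in the literature, are
  \<open>bot\<close> and \<open>top\<close> here.
\<close>

class comm_unital_quantale = complete_lattice + comm_monoid_mult +
  assumes mult_Sup_distrib: "x * Sup A = (SUP a\<in>A. x * a)"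

class integral_comm_quantale = comm_unital_quantale +
  assumes one_eq_top: "1 = top"

definition qimp :: "'q::comm_unital_quantale \<Rightarrow> 'q \<Rightarrow> 'q" where
  "qimp p r = Sup {q. p * q \<le> r}"

lemma quantale_mult_mono:
  fixes p p' q q' :: "'q::comm_unital_quantale"
  assumes "p \<le> p'" "q \<le> q'"
  shows "p * q \<le> p' * q'"
proof -
  have right: "a * b \<le> a * c" if "b \<le> c" for a b c :: 'q
  proof -
    have "a * c = a * Sup {b, c}" using that by (simp add: sup.absorb2)
    also have "\<dots> = (SUP t\<in>{b, c}. a * t)" by (rule mult_Sup_distrib)
    finally show ?thesis by (metis SUP_upper insertI1)
  qed
  have "p * q \<le> p * q'" using assms(2) by (rule right)
  also have "\<dots> \<le> p' * q'" using right[OF assms(1), of q'] by (simp add: mult.commute)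
  finally show ?thesis .
qed

lemma qimp_adjoint:
  fixes p q r :: "'q::comm_unital_quantale"
  shows "p * q \<le> r \<longleftrightarrow> q \<le> qimp p r"
proof
  show "p * q \<le> r \<Longrightarrow> q \<le> qimp p r" by (simp add: qimp_def Sup_upper)
  assume "q \<le> qimp p r"
  then have "p * q \<le> p * qimp p r" by (simp add: quantale_mult_mono)
  also have "\<dots> \<le> r" by (auto simp: qimp_def mult_Sup_distrib intro: SUP_least)
  finally show "p * q \<le> r" .
qed

text \<open>
  A \<open>Q\<close>-ordered set is given by a carrier \<open>X\<close> (possibly empty) and a map \<open>h\<close>, of which only
  the values on \<open>X \<times> X\<close> matter.  Maps from \<open>X\<close> to \<open>Q\<close> are the elements of \<open>X \<rightarrow>\<^sub>E UNIV\<close>, that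
  is, functions fixed to \<open>undefined\<close> outside \<open>X\<close>, so that two maps are equal iff they agree
  on \<open>X\<close>.
\<close>

definition Q_ordered_set :: "'x set \<Rightarrow> ('x \<Rightarrow> 'x \<Rightarrow> 'q::comm_unital_quantale) \<Rightarrow> bool" where
  "Q_ordered_set X h \<longleftrightarrow>
     (\<forall>x\<in>X. 1 \<le> h x x) \<and>
     (\<forall>x\<in>X. \<forall>y\<in>X. \<forall>z\<in>X. h y z * h x y \<le> h x z)"

definition Q_separated :: "'x set \<Rightarrow> ('x \<Rightarrow> 'x \<Rightarrow> 'q::comm_unital_quantale) \<Rightarrow> bool" where
  "Q_separated X h \<longleftrightarrow> (\<forall>x\<in>X. \<forall>y\<in>X. 1 \<le> inf (h x y) (h y x) \<longrightarrow> x = y)"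

definition weights :: "'x set \<Rightarrow> ('x \<Rightarrow> 'x \<Rightarrow> 'q::comm_unital_quantale) \<Rightarrow> ('x \<Rightarrow> 'q) set" where
  "weights X h = {\<phi> \<in> X \<rightarrow>\<^sub>E UNIV. \<forall>x\<in>X. \<forall>y\<in>X. \<phi> y * h x y \<le> \<phi> x}"

definition coweights :: "'x set \<Rightarrow> ('x \<Rightarrow> 'x \<Rightarrow> 'q::comm_unital_quantale) \<Rightarrow> ('x \<Rightarrow> 'q) set" where
  "coweights X h = {\<psi> \<in> X \<rightarrow>\<^sub>E UNIV. \<forall>x\<in>X. \<forall>y\<in>X. h x y * \<psi> x \<le> \<psi> y}"

definition Q_sub :: "'x set \<Rightarrow> ('x \<Rightarrow> 'q::comm_unital_quantale) \<Rightarrow> ('x \<Rightarrow> 'q) \<Rightarrow> 'q" where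
  "Q_sub X \<phi>1 \<phi>2 = (INF x\<in>X. qimp (\<phi>1 x) (\<phi>2 x))"

definition is_Q_sup ::
    "'x set \<Rightarrow> ('x \<Rightarrow> 'x \<Rightarrow> 'q::comm_unital_quantale) \<Rightarrow> ('x \<Rightarrow> 'q) \<Rightarrow> 'x \<Rightarrow> bool" where
  "is_Q_sup X h \<phi> a \<longleftrightarrow> a \<in> X \<and> (\<forall>y\<in>X. h a y = Q_sub X \<phi> (\<lambda>x\<in>X. h x y))"

definition Q_meets :: "'x set \<Rightarrow> ('x \<Rightarrow> 'q::comm_unital_quantale) \<Rightarrow> ('x \<Rightarrow> 'q) \<Rightarrow> 'q" where
  "Q_meets X \<phi> \<psi> = (SUP x\<in>X. \<phi> x * \<psi> x)"

definition flat_ideals ::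
    "'x set \<Rightarrow> ('x \<Rightarrow> 'x \<Rightarrow> 'q::comm_unital_quantale) \<Rightarrow> ('x \<Rightarrow> 'q) set" where
  "flat_ideals X h = {\<phi> \<in> weights X h.
     1 \<le> (SUP x\<in>X. \<phi> x) \<and>
     (\<forall>\<psi>1\<in>coweights X h. \<forall>\<psi>2\<in>coweights X h.
        Q_meets X \<phi> (\<lambda>x\<in>X. inf (\<psi>1 x) (\<psi>2 x)) = inf (Q_meets X \<phi> \<psi>1) (Q_meets X \<phi> \<psi>2))}"

text \<open>
  Suprema are handled relationally: in a separated \<open>Q\<close>-ordered set, at most one \<open>a\<close> satisfies
  \<open>is_Q_sup X h \<phi> a\<close>.
\<close>

definition F_domain :: "'x set \<Rightarrow> ('x \<Rightarrow> 'x \<Rightarrow> 'q::comm_unital_quantale) \<Rightarrow> bool" where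
  "F_domain X h \<longleftrightarrow>
     Q_ordered_set X h \<and> Q_separated X h \<and>
     (\<forall>\<phi>\<in>flat_ideals X h. \<exists>a. is_Q_sup X h \<phi> a) \<and>
     (\<forall>x\<in>X. \<exists>d\<in>flat_ideals X h. \<forall>\<phi>\<in>flat_ideals X h.
        \<forall>a. is_Q_sup X h \<phi> a \<longrightarrow> Q_sub X d \<phi> = h x a)"

definition scott_opens ::
    "'x set \<Rightarrow> ('x \<Rightarrow> 'x \<Rightarrow> 'q::comm_unital_quantale) \<Rightarrow> ('x \<Rightarrow> 'q) set" where
  "scott_opens X h = {\<psi> \<in> coweights X h.
     \<forall>\<phi>\<in>flat_ideals X h. \<forall>a. is_Q_sup X h \<phi> a \<longrightarrow> \<psi> a \<le> Q_meets X \<phi> \<psi>}"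

definition Q_topology :: "'x set \<Rightarrow> ('x \<Rightarrow> 'q::comm_unital_quantale) set \<Rightarrow> bool" where
  "Q_topology X T \<longleftrightarrow>
     T \<subseteq> (X \<rightarrow>\<^sub>E UNIV) \<and>
     (\<lambda>x\<in>X. top) \<in> T \<and>
     (\<forall>u\<in>T. \<forall>v\<in>T. (\<lambda>x\<in>X. inf (u x) (v x)) \<in> T) \<and>
     (\<forall>S. S \<subseteq> T \<longrightarrow> (\<lambda>x\<in>X. SUP u\<in>S. u x) \<in> T) \<and>
     (\<forall>u\<in>T. \<forall>r. (\<lambda>x\<in>X. u x * r) \<in> T)"

text \<open>
  A point is a map on the set of open sets; its values at other arguments are irrelevant.
\<close>

definition Q_point :: "'x set \<Rightarrow> ('x \<Rightarrow> 'q::comm_unital_quantale) set \<Rightarrow> (('x \<Rightarrow> 'q) \<Rightarrow> 'q) \<Rightarrow> bool" where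
  "Q_point X T p \<longleftrightarrow>
     p (\<lambda>x\<in>X. top) = top \<and>
     (\<forall>u\<in>T. \<forall>v\<in>T. p (\<lambda>x\<in>X. inf (u x) (v x)) = inf (p u) (p v)) \<and>
     (\<forall>S. S \<subseteq> T \<longrightarrow> p (\<lambda>x\<in>X. SUP u\<in>S. u x) = (SUP u\<in>S. p u)) \<and>
     (\<forall>u\<in>T. \<forall>r. p (\<lambda>x\<in>X. u x * r) = r * p u)"

definition Q_sober :: "'x set \<Rightarrow> ('x \<Rightarrow> 'q::comm_unital_quantale) set \<Rightarrow> bool" where
  "Q_sober X T \<longleftrightarrow>
     Q_topology X T \<and>
     (\<forall>p. Q_point X T p \<longrightarrow> (\<exists>!x. x \<in> X \<and> (\<forall>u\<in>T. p u = u x)))"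

lemma quantale_mult_SUP:
  fixes c :: "'q::comm_unital_quantale"
  shows "c * (SUP i\<in>I. f i) = (SUP i\<in>I. c * f i)"
  by (simp add: mult_Sup_distrib image_image)

lemma Q_topology_scott_opens:
  fixes X :: "'x set" and h :: "'x \<Rightarrow> 'x \<Rightarrow> 'q::integral_comm_quantale"
  shows "Q_topology X (scott_opens X h)"
  unfolding Q_topology_def
proof (intro conjI ballI allI impI)
  show "scott_opens X h \<subseteq> X \<rightarrow>\<^sub>E UNIV" by (auto simp: scott_opens_def coweights_def)
  have "Q_meets X \<phi> (\<lambda>x\<in>X. top) = top" if "\<phi> \<in> flat_ideals X h" for \<phi>
  proof -
    have "Q_meets X \<phi> (\<lambda>x\<in>X. top) = (SUP x\<in>X. \<phi> x)"
      unfolding Q_meets_def by (rule SUP_cong) (simp_all add: one_eq_top[symmetric])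
    moreover have "1 \<le> (SUP x\<in>X. \<phi> x)" using that by (simp add: flat_ideals_def)
    ultimately show ?thesis by (simp add: one_eq_top top_unique)
  qed
  moreover have "(\<lambda>x\<in>X. top) \<in> coweights X h" by (simp add: coweights_def)
  moreover have "a \<in> X" if "is_Q_sup X h \<phi> a" for \<phi> a using that by (simp add: is_Q_sup_def)
  ultimately show "(\<lambda>x\<in>X. top) \<in> scott_opens X h" by (simp add: scott_opens_def)
next
  fix u v assume uv: "u \<in> scott_opens X h" "v \<in> scott_opens X h"
  then have cw: "u \<in> coweights X h" "v \<in> coweights X h" by (auto simp: scott_opens_def)
  let ?w = "\<lambda>x\<in>X. inf (u x) (v x)"
  have "h x y * inf (u x) (v x) \<le> inf (u y) (v y)" if "x \<in> X" "y \<in> X" for x y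
  proof (rule le_infI)
    have "h x y * inf (u x) (v x) \<le> h x y * u x" by (simp add: quantale_mult_mono)
    also have "\<dots> \<le> u y" using cw that by (simp add: coweights_def)
    finally show "h x y * inf (u x) (v x) \<le> u y" .
    have "h x y * inf (u x) (v x) \<le> h x y * v x" by (simp add: quantale_mult_mono)
    also have "\<dots> \<le> v y" using cw that by (simp add: coweights_def)
    finally show "h x y * inf (u x) (v x) \<le> v y" .
  qed
  then have c: "?w \<in> coweights X h" by (simp add: coweights_def)
  have "?w a \<le> Q_meets X \<phi> ?w" if "\<phi> \<in> flat_ideals X h" "is_Q_sup X h \<phi> a" for \<phi> a
  proof -
    have "Q_meets X \<phi> ?w = inf (Q_meets X \<phi> u) (Q_meets X \<phi> v)"
      using that cw by (simp add: flat_ideals_def)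
    moreover have "u a \<le> Q_meets X \<phi> u" "v a \<le> Q_meets X \<phi> v"
      using uv that by (auto simp: scott_opens_def)
    moreover have "a \<in> X" using that by (simp add: is_Q_sup_def)
    ultimately show ?thesis by (simp add: le_infI1 le_infI2)
  qed
  with c show "?w \<in> scott_opens X h" by (auto simp: scott_opens_def)
next
  fix S assume S: "S \<subseteq> scott_opens X h"
  let ?w = "\<lambda>x\<in>X. SUP u\<in>S. u x"
  have "h x y * (SUP u\<in>S. u x) \<le> (SUP u\<in>S. u y)" if "x \<in> X" "y \<in> X" for x y
    unfolding quantale_mult_SUP
  proof (rule SUP_mono)
    fix u assume "u \<in> S"
    moreover from this have "h x y * u x \<le> u y"
      using S that by (auto simp: scott_opens_def coweights_def)
    ultimately show "\<exists>v\<in>S. h x y * u x \<le> v y" by blast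
  qed
  then have c: "?w \<in> coweights X h" by (simp add: coweights_def)
  have "?w a \<le> Q_meets X \<phi> ?w" if "\<phi> \<in> flat_ideals X h" "is_Q_sup X h \<phi> a" for \<phi> a
  proof -
    have "a \<in> X" using that by (simp add: is_Q_sup_def)
    have "u a \<le> Q_meets X \<phi> ?w" if u: "u \<in> S" for u
    proof -
      have "u a \<le> Q_meets X \<phi> u"
        using S u \<open>\<phi> \<in> flat_ideals X h\<close> \<open>is_Q_sup X h \<phi> a\<close> by (auto simp: scott_opens_def)
      also have "\<dots> \<le> Q_meets X \<phi> ?w"
        unfolding Q_meets_def
      proof (rule SUP_subset_mono[OF order_refl])
        fix x assume "x \<in> X"
        then show "\<phi> x * u x \<le> \<phi> x * ?w x"
          using SUP_upper[OF u, of "\<lambda>u. u x"] by (simp add: quantale_mult_mono)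
      qed
      finally show ?thesis .
    qed
    with \<open>a \<in> X\<close> show ?thesis by (auto intro: SUP_least)
  qed
  with c show "?w \<in> scott_opens X h" by (auto simp: scott_opens_def)
next
  fix u r assume u: "u \<in> scott_opens X h"
  let ?w = "\<lambda>x\<in>X. u x * r"
  have "h x y * (u x * r) \<le> u y * r" if "x \<in> X" "y \<in> X" for x y
  proof -
    have "h x y * u x \<le> u y" using u that by (simp add: scott_opens_def coweights_def)
    then show ?thesis by (simp add: mult.assoc[symmetric] quantale_mult_mono)
  qed
  then have c: "?w \<in> coweights X h" by (simp add: coweights_def)
  have "?w a \<le> Q_meets X \<phi> ?w" if "\<phi> \<in> flat_ideals X h" "is_Q_sup X h \<phi> a" for \<phi> a
  proof -
    have "a \<in> X" using that by (simp add: is_Q_sup_def)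
    have "Q_meets X \<phi> ?w = (SUP x\<in>X. r * (\<phi> x * u x))"
      unfolding Q_meets_def by (rule SUP_cong) (simp_all add: ac_simps)
    then have "Q_meets X \<phi> ?w = r * Q_meets X \<phi> u"
      by (simp add: Q_meets_def quantale_mult_SUP)
    moreover have "u a \<le> Q_meets X \<phi> u" using u that by (auto simp: scott_opens_def)
    ultimately show ?thesis using \<open>a \<in> X\<close> by (simp add: mult.commute quantale_mult_mono)
  qed
  with c show "?w \<in> scott_opens X h" by (auto simp: scott_opens_def)
qed

end

theory Submission
  imports Defs
begin

text \<open>
  In an \<open>\<F>\<close>-domain the flat ideal \<open>d x\<close> plays the role of the set of elements way below \<open>x\<close>.
  Three classical facts about continuous dcpos survive: the supremum of \<open>d x\<close> is \<open>x\<close>, \<open>d x\<close> lies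
  below every flat ideal with supremum \<open>x\<close>, and the relation \<open>d x y\<close> interpolates.  They yield a
  Scott interior operator: a coweight \<open>\<psi>\<close> has the Scott open interior
  \<open>\<psi>\<^sup>\<circ> x = (SUP y\<in>X. d x y * \<psi> y)\<close>.  In particular \<open>\<lambda>\<^sub>y = (\<lambda>x. d x y)\<close>, the interior of the
  principal coweight \<open>h y\<close>, is Scott open, and \<open>\<psi>\<^sup>\<circ>\<close> is the join of the open maps \<open>\<lambda>\<^sub>y * \<psi> y\<close>.
  The interior preserves binary meets because each \<open>d x\<close> is flat.

  Now let \<open>p\<close> be a point and put \<open>\<phi> y = p \<lambda>\<^sub>y\<close>.  Since \<open>p\<close> preserves joins and scalar multiples,
  \<open>p \<psi>\<^sup>\<circ> = (SUP y\<in>X. \<phi> y * \<psi> y)\<close> for every coweight \<open>\<psi>\<close>; since \<open>p\<close> preserves binary meets and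
  the top, this makes \<open>\<phi>\<close> a flat ideal.  Let \<open>a\<close> be its supremum.  For a Scott open \<open>\<psi>\<close>, which
  equals its interior, \<open>p \<psi> = (SUP y\<in>X. \<phi> y * \<psi> y)\<close> is at least \<open>\<psi> a\<close> by Scott openness, and it
  is at most \<open>\<psi> a\<close> because \<open>\<phi> y \<le> h y a\<close>.  So \<open>p\<close> is evaluation at \<open>a\<close>.  The point \<open>a\<close> is unique
  since the opens \<open>\<lambda>\<^sub>y\<close> determine \<open>d a\<close>, hence its supremum.
\<close>

section \<open>Weights, suprema and representable flat ideals\<close>

lemma quantale_mult_SUP_left:
  fixes c :: "'q::comm_unital_quantale"
  shows "(SUP i\<in>I. f i) * c = (SUP i\<in>I. f i * c)"
  using quantale_mult_SUP[of c f I] by (simp add: mult.commute)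

lemma le_Q_sub_iff: "r \<le> Q_sub X \<phi>1 \<phi>2 \<longleftrightarrow> (\<forall>x\<in>X. \<phi>1 x * r \<le> \<phi>2 x)"
  by (simp add: Q_sub_def le_INF_iff qimp_adjoint)

text \<open>
  The universal property of a supremum in a form without implications: lower bounds of \<open>h a y\<close>
  are easier to handle than residuals.
\<close>
lemma is_Q_sup_iff:
  "is_Q_sup X h \<phi> a \<longleftrightarrow>
     a \<in> X \<and> (\<forall>y\<in>X. \<forall>r. r \<le> h a y \<longleftrightarrow> (\<forall>x\<in>X. \<phi> x * r \<le> h x y))"
proof -
  have "h a y = Q_sub X \<phi> (\<lambda>x\<in>X. h x y) \<longleftrightarrow> (\<forall>r. r \<le> h a y \<longleftrightarrow> (\<forall>x\<in>X. \<phi> x * r \<le> h x y))" for y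
  proof -
    have "(\<forall>r. r \<le> h a y \<longleftrightarrow> r \<le> Q_sub X \<phi> (\<lambda>x\<in>X. h x y)) \<longleftrightarrow> h a y = Q_sub X \<phi> (\<lambda>x\<in>X. h x y)"
      by (metis order.antisym order.refl)
    then show ?thesis by (simp add: le_Q_sub_iff)
  qed
  then show ?thesis by (simp add: is_Q_sup_def)
qed

lemma Q_sup_upper:
  assumes "Q_ordered_set X h" "is_Q_sup X h \<phi> a" "y \<in> X"
  shows "\<phi> y \<le> h y a"
proof -
  have "a \<in> X" using assms(2) by (simp add: is_Q_sup_def)
  then have "1 \<le> h a a" using assms(1) by (simp add: Q_ordered_set_def)
  then have "\<phi> y * 1 \<le> h y a"
    using assms(2,3) \<open>a \<in> X\<close> unfolding is_Q_sup_iff by blast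
  then show ?thesis by simp
qed

lemma Q_sup_unique:
  assumes "Q_ordered_set X h" "Q_separated X h" "is_Q_sup X h \<phi> a" "is_Q_sup X h \<phi> b"
  shows "a = b"
proof -
  have "a \<in> X" "b \<in> X" using assms(3,4) by (auto simp: is_Q_sup_def)
  have "h a b = h b b" "h b a = h a a"
    using assms(3,4) \<open>a \<in> X\<close> \<open>b \<in> X\<close> by (simp_all add: is_Q_sup_def)
  then show ?thesis
    using assms(1,2) \<open>a \<in> X\<close> \<open>b \<in> X\<close> by (simp add: Q_ordered_set_def Q_separated_def)
qed

lemma principal_coweight:
  assumes "Q_ordered_set X h" "y \<in> X"
  shows "(\<lambda>x\<in>X. h y x) \<in> coweights X h"
  using assms by (simp add: coweights_def Q_ordered_set_def)

lemma inf_coweights: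
  assumes "\<psi>1 \<in> coweights X h" "\<psi>2 \<in> coweights X h"
  shows "(\<lambda>x\<in>X. inf (\<psi>1 x) (\<psi>2 x)) \<in> coweights X h"
proof -
  have "h x y * inf (\<psi>1 x) (\<psi>2 x) \<le> inf (\<psi>1 y) (\<psi>2 y)" if "x \<in> X" "y \<in> X" for x y
  proof -
    have "h x y * inf (\<psi>1 x) (\<psi>2 x) \<le> inf (h x y * \<psi>1 x) (h x y * \<psi>2 x)"
      by (simp add: quantale_mult_mono)
    also have "\<dots> \<le> inf (\<psi>1 y) (\<psi>2 y)"
      using assms that by (intro inf_mono) (simp_all add: coweights_def)
    finally show ?thesis .
  qed
  then show ?thesis by (simp add: coweights_def)
qed

lemma Q_meets_mono:
  assumes "\<And>x. x \<in> X \<Longrightarrow> \<phi> x \<le> \<phi>' x"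
  shows "Q_meets X \<phi> \<psi> \<le> Q_meets X \<phi>' \<psi>"
  unfolding Q_meets_def using assms by (intro SUP_subset_mono quantale_mult_mono order.refl)

text \<open>The Yoneda computation behind the flatness of representable weights.\<close>
lemma Q_meets_representable:
  assumes "Q_ordered_set X h" "a \<in> X" "\<psi> \<in> coweights X h"
  shows "Q_meets X (\<lambda>x\<in>X. h x a) \<psi> = \<psi> a"
proof (rule order.antisym)
  show "Q_meets X (\<lambda>x\<in>X. h x a) \<psi> \<le> \<psi> a"
    using assms by (auto simp: Q_meets_def coweights_def intro!: SUP_least)
  have "1 * \<psi> a \<le> h a a * \<psi> a"
    using assms by (intro quantale_mult_mono) (simp_all add: Q_ordered_set_def)
  also have "\<dots> \<le> Q_meets X (\<lambda>x\<in>X. h x a) \<psi>"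
    unfolding Q_meets_def using assms(2) by (auto intro!: SUP_upper2[of a])
  finally show "\<psi> a \<le> Q_meets X (\<lambda>x\<in>X. h x a) \<psi>" by simp
qed

lemma representable_flat_ideal:
  assumes "Q_ordered_set X h" "a \<in> X"
  shows "(\<lambda>x\<in>X. h x a) \<in> flat_ideals X h"
proof -
  have "(\<lambda>x\<in>X. h x a) \<in> weights X h"
    using assms by (simp add: weights_def Q_ordered_set_def)
  moreover have "1 \<le> (SUP x\<in>X. (\<lambda>x\<in>X. h x a) x)"
    using assms by (auto simp: Q_ordered_set_def intro: SUP_upper2[of a])
  ultimately show ?thesis
    using assms by (auto simp: flat_ideals_def Q_meets_representable inf_coweights)
qed

lemma representable_Q_sup:
  assumes "Q_ordered_set X h" "a \<in> X"
  shows "is_Q_sup X h (\<lambda>x\<in>X. h x a) a"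
  unfolding is_Q_sup_iff
proof (intro conjI ballI allI iffI)
  show "a \<in> X" by fact
next
  fix y r x assume "y \<in> X" "r \<le> h a y" "x \<in> X"
  then have "(\<lambda>x\<in>X. h x a) x * r \<le> h a y * h x a"
    by (simp add: mult.commute[of "h a y"] quantale_mult_mono)
  also have "\<dots> \<le> h x y"
    using assms \<open>x \<in> X\<close> \<open>y \<in> X\<close> by (simp add: Q_ordered_set_def)
  finally show "(\<lambda>x\<in>X. h x a) x * r \<le> h x y" .
next
  fix y r assume "\<forall>x\<in>X. (\<lambda>x\<in>X. h x a) x * r \<le> h x y"
  with assms have "h a a * r \<le> h a y" by auto
  moreover have "1 * r \<le> h a a * r"
    using assms by (intro quantale_mult_mono) (simp_all add: Q_ordered_set_def)
  ultimately show "r \<le> h a y" by simp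
qed

section \<open>The way-below ideals and interpolation\<close>

text \<open>
  The map \<open>d\<close> is fixed together with the domain, so that the choice of the left adjoint of
  \<open>sup\<close> is made only once.
\<close>
locale F_domain_with_way_below =
  fixes X :: "'x set" and h :: "'x \<Rightarrow> 'x \<Rightarrow> 'q::comm_unital_quantale" and d :: "'x \<Rightarrow> 'x \<Rightarrow> 'q"
  assumes ordered: "Q_ordered_set X h"
    and separated: "Q_separated X h"
    and sup_exists: "\<phi> \<in> flat_ideals X h \<Longrightarrow> \<exists>a. is_Q_sup X h \<phi> a"
    and d_flat: "x \<in> X \<Longrightarrow> d x \<in> flat_ideals X h"
    and Q_sub_d: "x \<in> X \<Longrightarrow> \<phi> \<in> flat_ideals X h \<Longrightarrow> is_Q_sup X h \<phi> a \<Longrightarrow> Q_sub X (d x) \<phi> = h x a"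
begin

lemma refl: "x \<in> X \<Longrightarrow> 1 \<le> h x x"
  using ordered by (simp add: Q_ordered_set_def)

lemma d_weight: "x \<in> X \<Longrightarrow> y \<in> X \<Longrightarrow> z \<in> X \<Longrightarrow> d x z * h y z \<le> d x y"
  using d_flat[of x] by (simp add: flat_ideals_def weights_def)

text \<open>
  The universal property of \<open>d x\<close>, tested against the representable weights, is literally the
  universal property of \<open>x\<close> as a supremum of \<open>d x\<close>.
\<close>
lemma Q_sup_d:
  assumes "x \<in> X"
  shows "is_Q_sup X h (d x) x"
  unfolding is_Q_sup_def
  using assms Q_sub_d[OF assms representable_flat_ideal representable_Q_sup] ordered by simp

lemma d_below: "x \<in> X \<Longrightarrow> y \<in> X \<Longrightarrow> d x y \<le> h y x"
  by (rule Q_sup_upper[OF ordered Q_sup_d])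

lemma d_least:
  assumes "\<phi> \<in> flat_ideals X h" "is_Q_sup X h \<phi> a" "y \<in> X"
  shows "d a y \<le> \<phi> y"
proof -
  have "a \<in> X" using assms(2) by (simp add: is_Q_sup_def)
  then have "1 \<le> Q_sub X (d a) \<phi>" using assms by (simp add: Q_sub_d refl)
  then show ?thesis using assms(3) by (auto simp: le_Q_sub_iff)
qed

lemma d_mono:
  assumes "x \<in> X" "z \<in> X" "y \<in> X"
  shows "h x z * d x y \<le> d z y"
proof -
  have "h x z \<le> Q_sub X (d x) (d z)"
    using assms Q_sub_d[OF \<open>x \<in> X\<close> d_flat Q_sup_d] by simp
  then show ?thesis using assms(3) by (simp add: le_Q_sub_iff mult.commute)
qed

definition interior :: "('x \<Rightarrow> 'q) \<Rightarrow> 'x \<Rightarrow> 'q" where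
  "interior \<psi> = (\<lambda>x\<in>X. Q_meets X (d x) \<psi>)"

lemma interior_coweight: "interior \<psi> \<in> coweights X h"
proof -
  have "h x z * Q_meets X (d x) \<psi> \<le> Q_meets X (d z) \<psi>" if "x \<in> X" "z \<in> X" for x z
    unfolding Q_meets_def quantale_mult_SUP
  proof (rule SUP_subset_mono[OF order.refl])
    fix y assume "y \<in> X"
    then show "h x z * (d x y * \<psi> y) \<le> d z y * \<psi> y"
      using d_mono that by (simp add: mult.assoc[symmetric] quantale_mult_mono)
  qed
  then show ?thesis by (simp add: interior_def coweights_def)
qed

lemma interior_inf:
  assumes "\<psi>1 \<in> coweights X h" "\<psi>2 \<in> coweights X h"
  shows "interior (\<lambda>x\<in>X. inf (\<psi>1 x) (\<psi>2 x)) = (\<lambda>x\<in>X. inf (interior \<psi>1 x) (interior \<psi>2 x))"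
  unfolding interior_def
proof (rule restrict_ext)
  fix x assume "x \<in> X"
  with d_flat assms show "Q_meets X (d x) (\<lambda>x\<in>X. inf (\<psi>1 x) (\<psi>2 x)) =
      inf ((\<lambda>x\<in>X. Q_meets X (d x) \<psi>1) x) ((\<lambda>x\<in>X. Q_meets X (d x) \<psi>2) x)"
    by (simp add: flat_ideals_def)
qed

text \<open>
  The way-below relation composed with itself; interpolation says that it contains the relation.
\<close>
definition d_comp :: "'x \<Rightarrow> 'x \<Rightarrow> 'q" where
  "d_comp x = (\<lambda>y\<in>X. SUP z\<in>X. d x z * d z y)"

text \<open>
  Interchanging two joins turns a pairing with the composite into a pairing of \<open>d x\<close> with an
  interior, to which flatness of \<open>d x\<close> applies.
\<close>
lemma Q_meets_d_comp: "Q_meets X (d_comp x) \<psi> = Q_meets X (d x) (interior \<psi>)"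
proof -
  have "Q_meets X (d_comp x) \<psi> = (SUP y\<in>X. SUP z\<in>X. d x z * (d z y * \<psi> y))"
    by (simp add: Q_meets_def d_comp_def quantale_mult_SUP_left mult.assoc)
  also have "\<dots> = (SUP z\<in>X. SUP y\<in>X. d x z * (d z y * \<psi> y))"
    by (rule SUP_commute)
  also have "\<dots> = Q_meets X (d x) (interior \<psi>)"
    by (simp add: Q_meets_def interior_def quantale_mult_SUP)
  finally show ?thesis .
qed

lemma d_comp_flat:
  assumes "x \<in> X"
  shows "d_comp x \<in> flat_ideals X h"
  unfolding flat_ideals_def
proof (intro CollectI conjI ballI)
  have "(SUP z\<in>X. d x z * d z y') * h y y' \<le> (SUP z\<in>X. d x z * d z y)"
    if "y \<in> X" "y' \<in> X" for y y'
    unfolding quantale_mult_SUP_left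
  proof (rule SUP_subset_mono[OF order.refl])
    fix z assume "z \<in> X"
    then show "d x z * d z y' * h y y' \<le> d x z * d z y"
      using d_weight that by (simp add: mult.assoc quantale_mult_mono)
  qed
  then show "d_comp x \<in> weights X h" by (simp add: weights_def d_comp_def)
next
  have tot: "1 \<le> (SUP y\<in>X. d z y)" if "z \<in> X" for z
    using d_flat[OF that] by (simp add: flat_ideals_def)
  have "1 \<le> (SUP z\<in>X. d x z * 1)" using tot[OF assms] by simp
  also have "\<dots> \<le> (SUP z\<in>X. d x z * (SUP y\<in>X. d z y))"
    using tot by (intro SUP_subset_mono quantale_mult_mono) simp_all
  also have "\<dots> = (SUP z\<in>X. SUP y\<in>X. d x z * d z y)"
    by (simp add: quantale_mult_SUP)
  also have "\<dots> = (SUP y\<in>X. SUP z\<in>X. d x z * d z y)"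
    by (rule SUP_commute)
  also have "\<dots> = (SUP y\<in>X. d_comp x y)" by (simp add: d_comp_def)
  finally show "1 \<le> (SUP y\<in>X. d_comp x y)" .
next
  fix \<psi>1 \<psi>2 assume "\<psi>1 \<in> coweights X h" "\<psi>2 \<in> coweights X h"
  then show "Q_meets X (d_comp x) (\<lambda>x\<in>X. inf (\<psi>1 x) (\<psi>2 x)) =
      inf (Q_meets X (d_comp x) \<psi>1) (Q_meets X (d_comp x) \<psi>2)"
    using d_flat[OF assms] interior_coweight
    by (simp add: Q_meets_d_comp interior_inf flat_ideals_def)
qed

lemma Q_sup_d_comp:
  assumes "x \<in> X"
  shows "is_Q_sup X h (d_comp x) x"
  unfolding is_Q_sup_iff
proof (intro conjI ballI allI)
  fix y r assume "y \<in> X"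
  have comp: "d_comp x u * r \<le> h u y \<longleftrightarrow> (\<forall>z\<in>X. d z u * (d x z * r) \<le> h u y)" if "u \<in> X" for u
    using that by (simp add: d_comp_def quantale_mult_SUP_left SUP_le_iff) (simp add: ac_simps)
  \<comment> \<open>Apply the universal property of \<open>x\<close> as supremum of \<open>d x\<close>, and then that of each \<open>z\<close> as
    supremum of \<open>d z\<close>.\<close>
  have "r \<le> h x y \<longleftrightarrow> (\<forall>z\<in>X. d x z * r \<le> h z y)"
    using Q_sup_d[OF assms] \<open>y \<in> X\<close> by (simp add: is_Q_sup_iff)
  also have "\<dots> \<longleftrightarrow> (\<forall>z\<in>X. \<forall>u\<in>X. d z u * (d x z * r) \<le> h u y)"
    using Q_sup_d \<open>y \<in> X\<close> by (simp add: is_Q_sup_iff)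
  also have "\<dots> \<longleftrightarrow> (\<forall>u\<in>X. d_comp x u * r \<le> h u y)"
    using comp by auto
  finally show "r \<le> h x y \<longleftrightarrow> (\<forall>u\<in>X. d_comp x u * r \<le> h u y)" .
qed (fact assms)

text \<open>
  Interpolation: \<open>d x\<close> is the least flat ideal with supremum \<open>x\<close>, and the composite is another
  one.
\<close>
lemma interpolation:
  assumes "x \<in> X" "y \<in> X"
  shows "d x y \<le> d_comp x y"
  using d_least[OF d_comp_flat Q_sup_d_comp] assms by blast

section \<open>The Scott interior of a coweight\<close>

lemma interior_scott_open: "interior \<psi> \<in> scott_opens X h"
proof -
  have "interior \<psi> a \<le> Q_meets X \<phi> (interior \<psi>)"
    if "\<phi> \<in> flat_ideals X h" "is_Q_sup X h \<phi> a" for \<phi> a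
  proof -
    have "a \<in> X" using that(2) by (simp add: is_Q_sup_def)
    then have "interior \<psi> a = Q_meets X (d a) \<psi>" by (simp add: interior_def)
    also have "\<dots> \<le> Q_meets X (d_comp a) \<psi>"
      using interpolation[OF \<open>a \<in> X\<close>] by (rule Q_meets_mono)
    also have "\<dots> = Q_meets X (d a) (interior \<psi>)" by (rule Q_meets_d_comp)
    also have "\<dots> \<le> Q_meets X \<phi> (interior \<psi>)"
      using d_least[OF that] by (rule Q_meets_mono)
    finally show ?thesis .
  qed
  then show ?thesis by (simp add: scott_opens_def interior_coweight)
qed

lemma interior_eq:
  assumes "\<psi> \<in> scott_opens X h"
  shows "interior \<psi> = \<psi>"
proof (rule extensionalityI[of _ X])
  show "interior \<psi> \<in> extensional X" by (simp add: interior_def)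
  have cw: "\<psi> \<in> coweights X h" using assms by (simp add: scott_opens_def)
  then show "\<psi> \<in> extensional X" by (simp add: coweights_def PiE_def)
  fix x assume "x \<in> X"
  show "interior \<psi> x = \<psi> x"
  proof (rule order.antisym)
    have "Q_meets X (d x) \<psi> \<le> Q_meets X (\<lambda>y\<in>X. h y x) \<psi>"
      using d_below \<open>x \<in> X\<close> by (intro Q_meets_mono) simp
    then show "interior \<psi> x \<le> \<psi> x"
      using \<open>x \<in> X\<close> cw ordered by (simp add: interior_def Q_meets_representable)
    show "\<psi> x \<le> interior \<psi> x"
      using assms d_flat Q_sup_d \<open>x \<in> X\<close> by (simp add: interior_def scott_opens_def)
  qed
qed

text \<open>
  The map \<open>\<lambda>\<^sub>y\<close> from the introduction.  Scaled by constants, these maps generate the Scott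
  topology under joins.
\<close>
definition way_above :: "'x \<Rightarrow> 'x \<Rightarrow> 'q" where
  "way_above y = (\<lambda>x\<in>X. d x y)"

lemma way_above_eq_interior:
  assumes "y \<in> X"
  shows "way_above y = interior (\<lambda>x\<in>X. h y x)"
  unfolding way_above_def interior_def
proof (rule restrict_ext)
  fix x assume "x \<in> X"
  show "d x y = Q_meets X (d x) (\<lambda>x\<in>X. h y x)"
  proof (rule order.antisym)
    have "d x y * 1 \<le> d x y * h y y" using assms refl by (intro quantale_mult_mono) simp_all
    also have "\<dots> \<le> Q_meets X (d x) (\<lambda>x\<in>X. h y x)"
      unfolding Q_meets_def using assms by (auto intro!: SUP_upper2[of y])
    finally show "d x y \<le> Q_meets X (d x) (\<lambda>x\<in>X. h y x)" by simp
    show "Q_meets X (d x) (\<lambda>x\<in>X. h y x) \<le> d x y"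
      using d_weight assms \<open>x \<in> X\<close> by (auto simp: Q_meets_def intro!: SUP_least)
  qed
qed

lemma way_above_scott_open: "y \<in> X \<Longrightarrow> way_above y \<in> scott_opens X h"
  by (simp add: way_above_eq_interior interior_scott_open)

lemma way_above_separates:
  assumes "x \<in> X" "x' \<in> X" "\<And>y. y \<in> X \<Longrightarrow> way_above y x = way_above y x'"
  shows "x = x'"
proof -
  have "d x y = d x' y" if "y \<in> X" for y
    using assms that by (simp add: way_above_def)
  then have "is_Q_sup X h (d x) x'"
    using Q_sup_d[OF \<open>x' \<in> X\<close>] by (simp add: is_Q_sup_iff)
  with Q_sup_d[OF \<open>x \<in> X\<close>] show ?thesis
    by (rule Q_sup_unique[OF ordered separated])
qed

end

section \<open>Points are evaluations\<close>

lemma Q_point_scale: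
  assumes "Q_point X T p" "u \<in> T"
  shows "p (\<lambda>x\<in>X. u x * r) = p u * r"
proof -
  have "p (\<lambda>x\<in>X. u x * r) = r * p u" using assms unfolding Q_point_def by blast
  then show ?thesis by (simp only: mult.commute)
qed

lemma Q_point_inf:
  assumes "Q_point X T p" "u \<in> T" "v \<in> T"
  shows "p (\<lambda>x\<in>X. inf (u x) (v x)) = inf (p u) (p v)"
  using assms unfolding Q_point_def by blast

lemma Q_point_mono:
  assumes "Q_topology X T" "Q_point X T p" "u \<in> T" "v \<in> T" "\<And>x. x \<in> X \<Longrightarrow> u x \<le> v x"
  shows "p u \<le> p v"
proof -
  have "u \<in> extensional X" using assms(1,3) by (auto simp: Q_topology_def PiE_def)
  then have "(\<lambda>x\<in>X. inf (u x) (v x)) = u"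
    using assms(5) by (intro extensionalityI[of _ X]) (simp_all add: inf.absorb1)
  then have "p u = inf (p u) (p v)" using Q_point_inf[OF assms(2-4)] by simp
  then show ?thesis by (simp add: inf.absorb_iff1)
qed

locale integral_F_domain = F_domain_with_way_below X h d
  for X :: "'x set" and h :: "'x \<Rightarrow> 'x \<Rightarrow> 'q::integral_comm_quantale" and d
begin

definition point_ideal :: "(('x \<Rightarrow> 'q) \<Rightarrow> 'q) \<Rightarrow> 'x \<Rightarrow> 'q" where
  "point_ideal p = (\<lambda>y\<in>X. p (way_above y))"

text \<open>
  The interior of \<open>\<psi>\<close> is the join of the basic opens \<open>way_above y\<close> scaled by \<open>\<psi> y\<close>, and a point
  preserves both operations.
\<close>
lemma point_interior:
  assumes "Q_point X (scott_opens X h) p"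
  shows "p (interior \<psi>) = Q_meets X (point_ideal p) \<psi>"
proof -
  let ?s = "\<lambda>y. \<lambda>x\<in>X. way_above y x * \<psi> y"
  have top: "Q_topology X (scott_opens X h)" by (rule Q_topology_scott_opens)
  have "?s y \<in> scott_opens X h" if "y \<in> X" for y
    using top way_above_scott_open[OF that] by (simp add: Q_topology_def)
  then have "?s ` X \<subseteq> scott_opens X h" by (rule image_subsetI)
  moreover have "\<forall>S. S \<subseteq> scott_opens X h \<longrightarrow> p (\<lambda>x\<in>X. SUP u\<in>S. u x) = (SUP u\<in>S. p u)"
    using assms unfolding Q_point_def by (elim conjE)
  ultimately have "p (\<lambda>x\<in>X. SUP u\<in>?s ` X. u x) = (SUP u\<in>?s ` X. p u)"
    by (elim allE[of _ "?s ` X"] impE)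
  moreover have "(\<lambda>x\<in>X. SUP u\<in>?s ` X. u x) = interior \<psi>"
    unfolding interior_def image_image
    by (rule restrict_ext) (simp add: Q_meets_def way_above_def)
  ultimately have "p (interior \<psi>) = (SUP y\<in>X. p (?s y))" by (simp add: image_image)
  also have "\<dots> = (SUP y\<in>X. point_ideal p y * \<psi> y)"
    by (rule SUP_cong)
      (simp_all add: Q_point_scale[OF assms way_above_scott_open] point_ideal_def)
  finally show ?thesis by (simp add: Q_meets_def)
qed

lemma point_ideal_flat:
  assumes p: "Q_point X (scott_opens X h) p"
  shows "point_ideal p \<in> flat_ideals X h"
  unfolding flat_ideals_def
proof (intro CollectI conjI ballI)
  have top: "Q_topology X (scott_opens X h)" by (rule Q_topology_scott_opens)
  have "p (way_above y) * h x y \<le> p (way_above x)" if "x \<in> X" "y \<in> X" for x y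
  proof -
    let ?u = "\<lambda>z\<in>X. way_above y z * h x y"
    have "?u \<in> scott_opens X h"
      using top way_above_scott_open[OF \<open>y \<in> X\<close>] by (simp add: Q_topology_def)
    moreover have "?u z \<le> way_above x z" if "z \<in> X" for z
      using \<open>x \<in> X\<close> \<open>y \<in> X\<close> that by (simp add: way_above_def d_weight)
    ultimately have "p ?u \<le> p (way_above x)"
      using way_above_scott_open[OF \<open>x \<in> X\<close>] by (intro Q_point_mono[OF top p])
    then show ?thesis
      using Q_point_scale[OF p way_above_scott_open[OF \<open>y \<in> X\<close>]] by simp
  qed
  then show "point_ideal p \<in> weights X h" by (simp add: weights_def point_ideal_def)
next
  let ?t = "\<lambda>x\<in>X. top"
  have "?t \<in> scott_opens X h"
    using Q_topology_scott_opens[of X h] by (simp add: Q_topology_def)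
  then have "Q_meets X (point_ideal p) ?t = p ?t"
    using point_interior[OF p, of ?t] by (simp add: interior_eq)
  then have "Q_meets X (point_ideal p) ?t = 1"
    using p by (simp add: Q_point_def one_eq_top)
  then show "1 \<le> (SUP y\<in>X. point_ideal p y)"
    by (simp add: Q_meets_def one_eq_top[symmetric])
next
  fix \<psi>1 \<psi>2 assume "\<psi>1 \<in> coweights X h" "\<psi>2 \<in> coweights X h"
  then show "Q_meets X (point_ideal p) (\<lambda>x\<in>X. inf (\<psi>1 x) (\<psi>2 x)) =
      inf (Q_meets X (point_ideal p) \<psi>1) (Q_meets X (point_ideal p) \<psi>2)"
    by (simp add: point_interior[OF p, symmetric] interior_inf
        Q_point_inf[OF p interior_scott_open interior_scott_open])
qed

text \<open>
  One inequality is Scott openness of \<open>u\<close> at the supremum \<open>a\<close>; the other holds because \<open>a\<close> is an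
  upper bound and \<open>u\<close> is a coweight.
\<close>
lemma point_eq_evaluation:
  assumes p: "Q_point X (scott_opens X h) p" and a: "is_Q_sup X h (point_ideal p) a"
    and u: "u \<in> scott_opens X h"
  shows "p u = u a"
proof (rule order.antisym)
  have cw: "u \<in> coweights X h" using u by (simp add: scott_opens_def)
  have "a \<in> X" using a by (simp add: is_Q_sup_def)
  have pu: "p u = Q_meets X (point_ideal p) u"
    using point_interior[OF p, of u] by (simp add: interior_eq[OF u])
  then show "u a \<le> p u"
    using u a point_ideal_flat[OF p] by (simp add: scott_opens_def)
  have "p u \<le> Q_meets X (\<lambda>y\<in>X. h y a) u"
    unfolding pu using Q_sup_upper[OF ordered a] by (intro Q_meets_mono) simp
  then show "p u \<le> u a"
    using ordered \<open>a \<in> X\<close> cw by (simp add: Q_meets_representable)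
qed

theorem scott_topology_sober: "Q_sober X (scott_opens X h)"
  unfolding Q_sober_def
proof (intro conjI allI impI)
  show "Q_topology X (scott_opens X h)" by (rule Q_topology_scott_opens)
  fix p assume p: "Q_point X (scott_opens X h) p"
  obtain a where a: "is_Q_sup X h (point_ideal p) a"
    using sup_exists[OF point_ideal_flat[OF p]] by blast
  show "\<exists>!x. x \<in> X \<and> (\<forall>u\<in>scott_opens X h. p u = u x)"
  proof (rule ex1I[of _ a])
    show a': "a \<in> X \<and> (\<forall>u\<in>scott_opens X h. p u = u a)"
      using a point_eq_evaluation[OF p a] by (simp add: is_Q_sup_def)
    fix x assume "x \<in> X \<and> (\<forall>u\<in>scott_opens X h. p u = u x)"
    with a' show "x = a"
      using way_above_scott_open by (intro way_above_separates) auto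
  qed
qed

end

theorem theorem4p10:
  fixes X :: "'x set" and h :: "'x \<Rightarrow> 'x \<Rightarrow> 'q::integral_comm_quantale"
  assumes "F_domain X h"
  shows "Q_sober X (scott_opens X h)"
proof -
  have "\<forall>x\<in>X. \<exists>d. d \<in> flat_ideals X h \<and>
      (\<forall>\<phi>\<in>flat_ideals X h. \<forall>a. is_Q_sup X h \<phi> a \<longrightarrow> Q_sub X d \<phi> = h x a)"
    using assms by (auto simp: F_domain_def)
  then obtain d where "\<forall>x\<in>X. d x \<in> flat_ideals X h \<and>
      (\<forall>\<phi>\<in>flat_ideals X h. \<forall>a. is_Q_sup X h \<phi> a \<longrightarrow> Q_sub X (d x) \<phi> = h x a)"
    using bchoice by metis
  with assms interpret integral_F_domain X h d
    by unfold_locales (auto simp: F_domain_def)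
  show ?thesis by (rule scott_topology_sober)
qed

end
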